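(* For all $k\in\mathbb{Z}_{\ge 0}$ and $n\in\mathbb{Z}_{\ge 1}$, $$\frac{1}{n!}\sum_{\sigma\in S_n}F(\sigma)^{k+1}=m_{k+1,n}^{[n]}=\dim\big(Z_{k+1,n}^{[n]}\big)=\dim\big(Z_{k+\frac12,n}^{[n-1]}\big)=m_{k+\frac12,n-1}^{[n-1]}=\frac{1}{(n-1)!}\sum_{\tau\in S_{n-1}}\big(F(\tau)+1\big)^{k},$$ where $m_{k+1,n}^{[n]}$ is the multiplicity of the trivial module $S_n^{[n]}$ in $M_n^{\otimes(k+1)}$, and $m_{k+\frac12,n-1}^{[n-1]}$ is the multiplicity of the trivial module $S_{n-1}^{[n-1]}$ in $M_n^{\otimes k}$ viewed as an $S_{n-1}$-module.
   Context: $\mathbb{F}$ is a field of characteristic zero. $M_n$ is the $n$-dimensional permutation module of $S_n$ over $\mathbb{F}$ with basis $v_1,\dots,v_n$, $\sigma.v_i=v_{\sigma(i)}$; $S_n$ acts diagonally on $M_n^{\otimes k}$, with $M_n^{\otimes 0}=\mathbb{F}$ trivial. $S_{n-1}\subseteq S_n$ is the subgroup fixing $n$ ($S_0$ is trivial). $S_n^\lambda$ is the irreducible $S_n$-module indexed by $\lambda\vdash n$; $S_n^{[n]}$ is the trivial module. $F(\sigma)$ is the number of fixed points of a permutation (for $\tau\in S_{n-1}$, fixed points in $\{1,\dots,n-1\}$). $Z_{k,n}=\mathrm{End}_{S_n}(M_n^{\otimes k})$ and $Z_{k+\frac12,n}=\mathrm{End}_{S_{n-1}}(M_n^{\otimes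 k})$. $Z_{k,n}^\lambda$ ($\lambda\vdash n$) is the irreducible $Z_{k,n}$-module indexed by $\lambda$ via Schur–Weyl duality, namely $\mathrm{Hom}_{S_n}(S_n^\lambda,M_n^{\otimes k})$, and $Z_{k+\frac12,n}^\mu$ ($\mu\vdash n-1$) is the irreducible $Z_{k+\frac12,n}$-module $\mathrm{Hom}_{S_{n-1}}(S_{n-1}^\mu,M_n^{\otimes k})$. *)

theory Defs
  imports Complex_Main "HOL-Library.FuncSet" "HOL-Library.Function_Algebras"
    "HOL-Combinatorics.Permutations"
begin

text \<open>
  \<open>S\<^sub>n\<close> consists of the permutations of the type \<^typ>\<open>nat\<close> that fix every point outside
  \<open>{1..n}\<close>. With this encoding \<open>S\<^sub>n\<^sub>-\<^sub>1\<close> is literally the subgroup of \<open>S\<^sub>n\<close> fixing \<open>n\<close>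
  (lemma \<open>Sym_pred\<close>), and restricting a module to \<open>S\<^sub>n\<^sub>-\<^sub>1\<close> only changes the set \<open>G\<close>
  of group elements below.
\<close>

definition Sym :: "nat \<Rightarrow> (nat \<Rightarrow> nat) set" where
  "Sym n = {\<sigma>. \<sigma> permutes {1..n}}"

definition fixed_points :: "nat \<Rightarrow> (nat \<Rightarrow> nat) \<Rightarrow> nat" where
  "fixed_points n \<sigma> = card {i \<in> {1..n}. \<sigma> i = i}"

lemma Sym_pred:
  assumes "n \<ge> 1"
  shows "Sym (n - 1) = {\<sigma> \<in> Sym n. \<sigma> n = n}"
proof (intro equalityI subsetI)
  fix \<sigma> assume s: "\<sigma> \<in> Sym (n - 1)"
  then have p: "\<sigma> permutes {1..n - 1}"
    by (simp add: Sym_def)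
  have "\<sigma> permutes {1..n}"
    by (rule permutes_subset[OF p]) auto
  moreover have "\<sigma> n = n"
    using assms by (intro permutes_not_in[OF p]) auto
  ultimately show "\<sigma> \<in> {\<sigma> \<in> Sym n. \<sigma> n = n}"
    by (simp add: Sym_def)
next
  fix \<sigma> assume s: "\<sigma> \<in> {\<sigma> \<in> Sym n. \<sigma> n = n}"
  then have "\<sigma> permutes {1..n}" "\<sigma> n = n"
    by (auto simp: Sym_def)
  then have "\<sigma> permutes {1..n - 1}"
    by (elim permutes_superset) (auto, use le_antisym in fastforce)
  then show "\<sigma> \<in> Sym (n - 1)"
    by (simp add: Sym_def)
qed


text \<open>Modules of a permutation group over a field, on a subspace of an ambient vector space.\<close>

record ('a, 'v) gmod =
  mspace :: "'v set"
  mscale :: "'a \<Rightarrow> 'v \<Rightarrow> 'v"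
  mact :: "(nat \<Rightarrow> nat) \<Rightarrow> 'v \<Rightarrow> 'v"

definition gmodule ::
  "(nat \<Rightarrow> nat) set \<Rightarrow> ('a::field, 'v::ab_group_add) gmod \<Rightarrow> bool" where
  "gmodule G M \<longleftrightarrow>
     vector_space (mscale M) \<and> module.subspace (mscale M) (mspace M) \<and>
     (\<forall>g\<in>G. \<forall>x\<in>mspace M. mact M g x \<in> mspace M) \<and>
     (\<forall>g\<in>G. \<forall>x\<in>mspace M. \<forall>y\<in>mspace M. mact M g (x + y) = mact M g x + mact M g y) \<and>
     (\<forall>g\<in>G. \<forall>c. \<forall>x\<in>mspace M. mact M g (mscale M c x) = mscale M c (mact M g x)) \<and>
     (\<forall>x\<in>mspace M. mact M id x = x) \<and>
     (\<forall>g\<in>G. \<forall>h\<in>G. \<forall>x\<in>mspace M. mact M (g \<circ> h) x = mact M g (mact M h x))"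

definition submodule ::
  "(nat \<Rightarrow> nat) set \<Rightarrow> 'v set \<Rightarrow> ('a::field, 'v::ab_group_add) gmod \<Rightarrow> bool" where
  "submodule G U M \<longleftrightarrow> U \<subseteq> mspace M \<and> gmodule G (M\<lparr>mspace := U\<rparr>)"

definition irreducible_module ::
  "(nat \<Rightarrow> nat) set \<Rightarrow> ('a::field, 'v::ab_group_add) gmod \<Rightarrow> bool" where
  "irreducible_module G M \<longleftrightarrow>
     gmodule G M \<and> mspace M \<noteq> {0} \<and>
     (\<forall>U. submodule G U M \<longrightarrow> U = {0} \<or> U = mspace M)"

text \<open>
  Homomorphisms are made zero outside the domain, so that each of them is represented by
  exactly one function and they form a vector space under the pointwise operations.
\<close>

definition GHom ::
  "(nat \<Rightarrow> nat) set \<Rightarrow> ('a::field, 'v::ab_group_add) gmod \<Rightarrow> ('a, 'w::ab_group_add) gmod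
    \<Rightarrow> ('v \<Rightarrow> 'w) set" where
  "GHom G V W = {f.
     (\<forall>x\<in>mspace V. f x \<in> mspace W) \<and> (\<forall>x. x \<notin> mspace V \<longrightarrow> f x = 0) \<and>
     (\<forall>x\<in>mspace V. \<forall>y\<in>mspace V. f (x + y) = f x + f y) \<and>
     (\<forall>c. \<forall>x\<in>mspace V. f (mscale V c x) = mscale W c (f x)) \<and>
     (\<forall>g\<in>G. \<forall>x\<in>mspace V. f (mact V g x) = mact W g (f x))}"

definition fun_scale :: "('a::times) \<Rightarrow> ('x \<Rightarrow> 'a) \<Rightarrow> 'x \<Rightarrow> 'a" where
  "fun_scale c f = (\<lambda>x. c * f x)"

definition hom_scale :: "('a, 'w) gmod \<Rightarrow> 'a \<Rightarrow> ('v \<Rightarrow> 'w) \<Rightarrow> 'v \<Rightarrow> 'w" where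
  "hom_scale W c f = (\<lambda>x. mscale W c (f x))"

definition isomorphic_modules ::
  "(nat \<Rightarrow> nat) set \<Rightarrow> ('a::field, 'v::ab_group_add) gmod \<Rightarrow> ('a, 'w::ab_group_add) gmod \<Rightarrow> bool" where
  "isomorphic_modules G V W \<longleftrightarrow> (\<exists>f\<in>GHom G V W. bij_betw f (mspace V) (mspace W))"

text \<open>
  \<open>M\<close> is the internal direct sum of the irreducible submodules in \<open>D\<close>: every vector of \<open>M\<close> is
  in exactly one way a sum of vectors \<open>w W \<in> W\<close>. A set \<open>D\<close> is enough, since nonzero summands of
  a direct sum are distinct as subspaces even if they are isomorphic.
\<close>

definition irreducible_decomposition ::
  "(nat \<Rightarrow> nat) set \<Rightarrow> ('a::field, 'v::ab_group_add) gmod \<Rightarrow> 'v set set \<Rightarrow> bool" where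
  "irreducible_decomposition G M D \<longleftrightarrow>
     finite D \<and>
     (\<forall>W\<in>D. submodule G W M \<and> irreducible_module G (M\<lparr>mspace := W\<rparr>)) \<and>
     bij_betw (\<lambda>w. \<Sum>W\<in>D. w W) (\<Pi>\<^sub>E W\<in>D. W) (mspace M)"

text \<open>
  The description by \<open>THE\<close> is meaningful only if some decomposition exists and the number of
  summands isomorphic to \<open>S\<close> is the same for all of them.
\<close>

definition multiplicity_of ::
  "(nat \<Rightarrow> nat) set \<Rightarrow> ('a::field, 'w::ab_group_add) gmod \<Rightarrow> ('a, 'v::ab_group_add) gmod \<Rightarrow> nat" where
  "multiplicity_of G S M =
     (THE m. \<exists>D. irreducible_decomposition G M D \<and>
        m = card {W \<in> D. isomorphic_modules G (M\<lparr>mspace := W\<rparr>) S})"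

text \<open>The trivial module on the field; over \<open>S\<^sub>n\<close> this is the module indexed by \<open>[n]\<close>.\<close>

definition trivial_module :: "('a::field, 'a) gmod" where
  "trivial_module = \<lparr>mspace = UNIV, mscale = (*), mact = (\<lambda>g x. x)\<rparr>"

text \<open>
  \<open>M\<^sub>n\<close> is realised as the functions \<open>f\<close> supported on \<open>{1..n}\<close>, with \<open>f\<close> standing for
  \<open>\<Sum>i. f i v\<^sub>i\<close>. Then \<open>\<sigma>.v\<^sub>i = v\<^bsub>\<sigma> i\<^esub>\<close> becomes \<open>\<sigma>.f = f \<circ> \<sigma>\<^sup>-\<^sup>1\<close>.
\<close>

definition perm_module :: "nat \<Rightarrow> ('a::field, nat \<Rightarrow> 'a) gmod" where
  "perm_module n =
     \<lparr>mspace = {f. \<forall>i. i \<notin> {1..n} \<longrightarrow> f i = 0},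
      mscale = fun_scale,
      mact = (\<lambda>\<sigma> f i. f (inv \<sigma> i))\<rparr>"

definition basis_vec :: "'x \<Rightarrow> 'x \<Rightarrow> 'a::field" where
  "basis_vec x = (\<lambda>y. if y = x then 1 else 0)"

text \<open>
  The \<open>k\<close>-th tensor power is realised as the functions supported on the lists of length \<open>k\<close>
  over \<open>{1..n}\<close>, with \<^term>\<open>basis_vec [r\<^sub>1, r\<^sub>2]\<close> standing for \<open>v\<^bsub>r\<^sub>1\<^esub> \<otimes> v\<^bsub>r\<^sub>2\<^esub>\<close>.
  For \<open>k = 0\<close> only the empty list remains, which gives the trivial one-dimensional module.
  That this is the tensor power with the diagonal action is \<open>tensor_power_span\<close>,
  \<open>tensor_multilinear\<close>, \<open>tensor_basis\<close> and \<open>mact_tensor\<close> below.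
\<close>

definition tuples :: "nat \<Rightarrow> nat \<Rightarrow> nat list set" where
  "tuples k n = {xs. length xs = k \<and> set xs \<subseteq> {1..n}}"

definition tensor_power :: "nat \<Rightarrow> nat \<Rightarrow> ('a::field, nat list \<Rightarrow> 'a) gmod" where
  "tensor_power k n =
     \<lparr>mspace = {f. \<forall>xs. xs \<notin> tuples k n \<longrightarrow> f xs = 0},
      mscale = fun_scale,
      mact = (\<lambda>\<sigma> f xs. f (map (inv \<sigma>) xs))\<rparr>"

text \<open>\<open>tensor [w\<^sub>1, \<dots>, w\<^sub>k]\<close> is the elementary tensor \<open>w\<^sub>1 \<otimes> \<dots> \<otimes> w\<^sub>k\<close>.\<close>

definition tensor :: "(nat \<Rightarrow> 'a::field) list \<Rightarrow> nat list \<Rightarrow> 'a" where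
  "tensor ws = (\<lambda>xs. if length xs = length ws then \<Prod>i<length ws. (ws ! i) (xs ! i) else 0)"

text \<open>
  \<open>Z_module k n S\<close> is \<open>Hom\<close> over \<open>S\<^sub>n\<close> from \<open>S\<close> to the \<open>k\<close>-th tensor power of \<open>M\<^sub>n\<close>, and
  \<open>Z_half_module k n S\<close> is the same over \<open>S\<^sub>n\<^sub>-\<^sub>1\<close>. The algebras \<open>Z_algebra\<close> and
  \<open>Z_half_algebra\<close> act on them by composition (lemma \<open>GHom_compose\<close>).
\<close>

definition Z_algebra :: "nat \<Rightarrow> nat \<Rightarrow> ((nat list \<Rightarrow> 'a::field) \<Rightarrow> nat list \<Rightarrow> 'a) set" where
  "Z_algebra k n = GHom (Sym n) (tensor_power k n) (tensor_power k n)"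

definition Z_half_algebra :: "nat \<Rightarrow> nat \<Rightarrow> ((nat list \<Rightarrow> 'a::field) \<Rightarrow> nat list \<Rightarrow> 'a) set" where
  "Z_half_algebra k n = GHom (Sym (n - 1)) (tensor_power k n) (tensor_power k n)"

definition Z_module ::
  "nat \<Rightarrow> nat \<Rightarrow> ('a::field, 'v::ab_group_add) gmod \<Rightarrow> ('v \<Rightarrow> nat list \<Rightarrow> 'a) set" where
  "Z_module k n S = GHom (Sym n) S (tensor_power k n)"

definition Z_half_module ::
  "nat \<Rightarrow> nat \<Rightarrow> ('a::field, 'v::ab_group_add) gmod \<Rightarrow> ('v \<Rightarrow> nat list \<Rightarrow> 'a) set" where
  "Z_half_module k n S = GHom (Sym (n - 1)) S (tensor_power k n)"

definition Z_dim :: "nat \<Rightarrow> nat \<Rightarrow> ('v \<Rightarrow> nat list \<Rightarrow> 'a::field) set \<Rightarrow> nat" where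
  "Z_dim k n = vector_space.dim (hom_scale (tensor_power k n))"


subsection \<open>Consistency of the encoding\<close>

lemma vector_space_fun_scale: "vector_space (fun_scale :: 'a::field \<Rightarrow> ('x \<Rightarrow> 'a) \<Rightarrow> 'x \<Rightarrow> 'a)"
  by unfold_locales (auto simp: fun_scale_def fun_eq_iff algebra_simps)

lemma vector_space_hom_scale:
  "vector_space (hom_scale (tensor_power k n) :: 'a::field \<Rightarrow> ('v \<Rightarrow> nat list \<Rightarrow> 'a) \<Rightarrow> _)"
  by unfold_locales
    (auto simp: hom_scale_def tensor_power_def fun_scale_def fun_eq_iff algebra_simps)

lemma gmodule_mono: "gmodule G M \<Longrightarrow> H \<subseteq> G \<Longrightarrow> gmodule H M"
  unfolding gmodule_def by blast

lemma GHom_compose: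
  assumes "f \<in> GHom G U V" "g \<in> GHom G V W" "0 \<in> mspace V"
  shows "g \<circ> f \<in> GHom G U W"
proof -
  have "g (0 + 0) = g 0 + g 0"
    using assms(2,3) unfolding GHom_def by blast
  then have "g 0 = 0"
    by simp
  then show ?thesis
    using assms(1,2) by (auto simp: GHom_def)
qed

lemma subspace_GHom:
  fixes S :: "('a::field, 'v::ab_group_add) gmod"
  shows "module.subspace (hom_scale (tensor_power k n)) (GHom G S (tensor_power k n))"
proof -
  interpret vector_space "hom_scale (tensor_power k n) :: 'a \<Rightarrow> ('v \<Rightarrow> nat list \<Rightarrow> 'a) \<Rightarrow> _"
    by (rule vector_space_hom_scale)
  show ?thesis
    unfolding subspace_def
    by (auto simp: GHom_def hom_scale_def tensor_power_def fun_scale_def fun_eq_iff algebra_simps)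
qed

lemma trivial_module_irreducible: "irreducible_module G (trivial_module :: ('a::field, 'a) gmod)"
proof -
  interpret vector_space "(*) :: 'a \<Rightarrow> 'a \<Rightarrow> 'a"
    by unfold_locales (auto simp: algebra_simps)
  have "U = {0} \<or> U = UNIV" if U: "subspace U" for U :: "'a set"
  proof (cases "U \<subseteq> {0}")
    case True
    then show ?thesis
      using subspace_0[OF U] by auto
  next
    case False
    then obtain u where u: "u \<in> U" "u \<noteq> 0"
      by auto
    have "x \<in> U" for x
      using subspace_scale[OF U u(1), of "x / u"] u(2) by simp
    then show ?thesis
      by auto
  qed
  moreover have "(UNIV :: 'a set) \<noteq> {0}"
    by (metis UNIV_I singletonD zero_neq_one)
  ultimately show ?thesis
    by (auto simp: irreducible_module_def submodule_def gmodule_def trivial_module_def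
        vector_space_axioms subspace_UNIV)
qed

lemma map_inv_tuples:
  assumes "\<sigma> \<in> Sym n"
  shows "map (inv \<sigma>) xs \<in> tuples k n \<longleftrightarrow> xs \<in> tuples k n"
proof -
  have p: "inv \<sigma> permutes {1..n}"
    using assms by (simp add: Sym_def permutes_inv)
  show ?thesis
    using permutes_in_image[OF p] by (auto simp: tuples_def)
qed

lemma gmodule_tensor_power: "gmodule (Sym n) (tensor_power k n :: ('a::field, _) gmod)"
proof -
  interpret vector_space "fun_scale :: 'a \<Rightarrow> (nat list \<Rightarrow> 'a) \<Rightarrow> _"
    by (rule vector_space_fun_scale)
  have "inv (g \<circ> h) = inv h \<circ> inv g" if "g \<in> Sym n" "h \<in> Sym n" for g h
    using that by (auto simp: Sym_def intro!: o_inv_distrib permutes_bij)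
  then show ?thesis
    unfolding gmodule_def tensor_power_def
    by (auto simp: vector_space_axioms subspace_def map_inv_tuples inv_id[unfolded id_def])
      (auto simp: fun_scale_def fun_eq_iff algebra_simps)
qed

lemma mact_perm_module_basis:
  assumes "\<sigma> \<in> Sym n"
  shows "mact (perm_module n) \<sigma> (basis_vec i) = basis_vec (\<sigma> i)"
  using assms permutes_inv_eq[of \<sigma> "{1..n}"]
  by (auto simp: Sym_def perm_module_def basis_vec_def fun_eq_iff)

lemma mact_tensor:
  "mact (tensor_power k n) \<sigma> (tensor ws) = tensor (map (mact (perm_module n) \<sigma>) ws)"
  by (auto simp: tensor_power_def perm_module_def tensor_def fun_eq_iff intro!: prod.cong)

lemma tensor_multilinear:
  fixes u v :: "nat \<Rightarrow> 'a::field"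
  shows "tensor (us @ (fun_scale a u + fun_scale b v) # ws) =
     fun_scale a (tensor (us @ u # ws)) + fun_scale b (tensor (us @ v # ws))"
proof -
  let ?m = "length us"
  have nth: "(us @ y # ws) ! i = (us @ u # ws) ! i" if "i \<noteq> ?m" for y i
    using that by (cases "i < ?m") (auto simp: nth_append nth_Cons')
  have *: "(\<Prod>i<Suc (?m + length ws). ((us @ y # ws) ! i) (xs ! i)) =
      y (xs ! ?m) * (\<Prod>i\<in>{..<Suc (?m + length ws)} - {?m}. ((us @ u # ws) ! i) (xs ! i))"
    for y :: "nat \<Rightarrow> 'a" and xs
  proof -
    have "(\<Prod>i\<in>{..<Suc (?m + length ws)} - {?m}. ((us @ y # ws) ! i) (xs ! i)) =
        (\<Prod>i\<in>{..<Suc (?m + length ws)} - {?m}. ((us @ u # ws) ! i) (xs ! i))"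
      by (intro prod.cong refl, subst nth) auto
    then show ?thesis
      by (subst prod.remove[of _ ?m]) (simp_all del: prod.lessThan_Suc)
  qed
  show ?thesis
    by (auto simp: tensor_def fun_eq_iff fun_scale_def * algebra_simps simp del: prod.lessThan_Suc)
qed

lemma tensor_basis: "tensor (map basis_vec rs) = basis_vec rs"
proof
  fix xs
  have "(\<forall>i<length rs. xs ! i = rs ! i) \<longleftrightarrow> xs = rs" if "length xs = length rs"
    using that by (auto intro: nth_equalityI)
  then show "tensor (map basis_vec rs) xs = basis_vec rs xs"
    by (auto simp: tensor_def basis_vec_def intro!: prod.neutral)
qed

lemma tensor_power_span:
  "mspace (tensor_power k n :: ('a::field, _) gmod) =
     module.span fun_scale {tensor ws |ws. length ws = k \<and> set ws \<subseteq> mspace (perm_module n)}"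
    (is "?M = module.span _ ?T")
proof -
  interpret vector_space "fun_scale :: 'a \<Rightarrow> (nat list \<Rightarrow> 'a) \<Rightarrow> _"
    by (rule vector_space_fun_scale)
  have fin: "finite (tuples k n)"
    unfolding tuples_def using finite_lists_length_eq[of "{1..n}" k] by (simp add: conj_commute)
  have sub: "subspace ?M"
    by (auto simp: subspace_def tensor_power_def fun_scale_def)
  have "?T \<subseteq> ?M"
  proof clarify
    fix ws :: "(nat \<Rightarrow> 'a) list"
    assume ws: "set ws \<subseteq> mspace (perm_module n)" and k: "k = length ws"
    have "tensor ws xs = 0" if xs: "xs \<notin> tuples k n" for xs
    proof (cases "length xs = length ws")
      case True
      then have "\<not> set xs \<subseteq> {1..n}"
        using xs k by (simp add: tuples_def)
      then obtain y where "y \<in> set xs" "y \<notin> {1..n}"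
        by blast
      then obtain i where i: "i < length ws" "xs ! i \<notin> {1..n}"
        using True by (metis in_set_conv_nth)
      have "(ws ! i) (xs ! i) = 0"
        using subsetD[OF ws nth_mem[OF i(1)]] i(2) by (simp add: perm_module_def)
      with i True show ?thesis
        by (auto simp: tensor_def intro!: bexI[of _ i])
    qed (simp add: tensor_def)
    then show "tensor ws \<in> mspace (tensor_power (length ws) n)"
      by (simp add: tensor_power_def k)
  qed
  then have "span ?T \<subseteq> ?M"
    using sub by (rule span_minimal)
  moreover have "f \<in> span ?T" if f: "f \<in> ?M" for f
  proof -
    have "basis_vec rs \<in> ?T" if "rs \<in> tuples k n" for rs
    proof -
      have "set (map basis_vec rs) \<subseteq> mspace (perm_module n :: ('a, _) gmod)"
        using that by (fastforce simp: tuples_def perm_module_def basis_vec_def)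
      moreover have "length (map basis_vec rs :: (nat \<Rightarrow> 'a) list) = k"
        using that by (simp add: tuples_def)
      ultimately show ?thesis
        unfolding tensor_basis[symmetric] by blast
    qed
    then have "(\<Sum>rs\<in>tuples k n. fun_scale (f rs) (basis_vec rs)) \<in> span ?T"
      by (intro span_sum span_scale span_base)
    moreover have "(\<Sum>rs\<in>A. fun_scale (f rs) (basis_vec rs)) xs = (if xs \<in> A then f xs else 0)"
      if "finite A" for A xs
      using that by induction (auto simp: fun_scale_def basis_vec_def)
    then have "(\<Sum>rs\<in>tuples k n. fun_scale (f rs) (basis_vec rs)) = f"
      using f fin by (auto simp: fun_eq_iff tensor_power_def)
    ultimately show ?thesis
      by simp
  qed
  ultimately show ?thesis
    by blast
qed

end

theory Submission
  imports Defs "HOL-Algebra.Group_Action" "HOL-Algebra.Sym_Groups"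
begin

text \<open>
  Every quantity in the chain is expressed by the space of fixed vectors of a finite group \<open>G\<close> in a
  module \<open>M\<close>, where \<open>G\<close> is \<open>S\<^sub>n\<close> or \<open>S\<^sub>n\<^sub>-\<^sub>1\<close> and \<open>M\<close> is a tensor power of the
  permutation module \<open>M\<^sub>n\<close>.

  By Maschke's theorem \<open>M\<close> has a decomposition into irreducible submodules
  (\<open>irreducible_decomposition_exists\<close>). In each decomposition the trivial summands are lines
  that together make up the space of fixed vectors, so their number is its dimension
  (\<open>card_trivial_summands\<close>), and the multiplicity of the trivial module is well defined. On the
  other hand, evaluation at \<open>1\<close> identifies the homomorphisms from the trivial module to \<open>M\<close> with
  the fixed vectors (\<open>dim_hom_trivial\<close>).

  The \<open>k\<close>-th tensor power has the \<open>k\<close>-tuples over \<open>{1..n}\<close> as a basis, which \<open>G\<close> permutes.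
  Hence the indicator functions of the orbits of tuples form a basis of the fixed space
  (\<open>dim_fixed_vectors\<close>), and Burnside's lemma counts the orbits: since \<open>\<sigma>\<close> fixes exactly those tuples whose entries it fixes, the number of
  orbits is the mean of \<open>F(\<sigma>)\<^sup>k\<close> over \<open>G\<close>, with fixed points taken in \<open>{1..n}\<close>
  (\<open>burnside_fixed_vectors\<close>). An element of \<open>S\<^sub>n\<^sub>-\<^sub>1\<close> fixes \<open>n\<close> in addition to its fixed
  points in \<open>{1..n - 1}\<close>; this is the summand \<open>1\<close> in \<open>F(\<tau>) + 1\<close>.

  What links the two groups is a double count of the pairs of a permutation \<open>\<sigma>\<close> in \<open>S\<^sub>n\<close> and a
  fixed point \<open>i\<close> of \<open>\<sigma>\<close>, each with weight \<open>F(\<sigma>)\<^sup>k\<close>: all \<open>n\<close> point stabilizers are conjugate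
  to \<open>S\<^sub>n\<^sub>-\<^sub>1\<close>, so they contribute equally (\<open>sum_fixed_points_Suc\<close>).
\<close>

section \<open>Dimension\<close>

text \<open>
  A basis of \<open>V\<close> together with a vector of \<open>U\<close> outside \<open>V\<close> extends to a basis of \<open>U\<close>.
  Finite dimension is asked of \<open>U\<close> and not of the ambient space, because modules are realised
  inside infinite-dimensional function spaces.
\<close>

lemma (in vector_space) dim_strict_mono_subspace:
  assumes "subspace V" "V \<subset> U" "U \<subseteq> span B" "finite B"
  shows "dim V < dim U"
proof -
  obtain A where A: "A \<subseteq> V" "independent A" "V \<subseteq> span A"
    by (rule maximal_independent_subset)
  obtain x where x: "x \<in> U" "x \<notin> V"
    using assms(2) by blast
  have "span A \<subseteq> V"
    using A(1) assms(1) by (rule span_minimal)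
  then have ind: "independent (insert x A)"
    using x(2) A(2) by (intro independent_insertI) auto
  have "insert x A \<subseteq> U"
    using x(1) A(1) assms(2) by blast
  then obtain C where C: "insert x A \<subseteq> C" "C \<subseteq> U" "independent C" "U \<subseteq> span C"
    by (rule maximal_independent_subset_extend[OF _ ind])
  have fin: "finite C"
    using independent_span_bound[OF assms(4) C(3)] C(2) assms(3) by blast
  then have "finite A"
    using C(1) finite_subset[of A C] by simp
  moreover have "x \<notin> A"
    using A(1) x(2) by blast
  ultimately have "card A < card C"
    using card_mono[OF fin C(1)] by simp
  then show ?thesis
    using basis_card_eq_dim[OF A(1,3,2)] basis_card_eq_dim[OF C(2,4,3)] by simp
qed

lemma (in vector_space_pair) dim_injective_image:
  assumes "Vector_Spaces.linear s1 s2 f" "inj_on f (vs1.span S)"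
  shows "vs2.dim (f ` S) = vs1.dim S"
proof -
  obtain B where B: "B \<subseteq> S" "vs1.independent B" "S \<subseteq> vs1.span B" "card B = vs1.dim S"
    by (rule vs1.basis_exists)
  have "inj_on f (vs1.span B)"
    by (rule inj_on_subset[OF assms(2) vs1.span_mono[OF B(1)]])
  then have "vs2.independent (f ` B)" and "inj_on f B"
    using linear_independent_injective_image[OF assms(1) B(2)]
      inj_on_subset[OF _ vs1.span_superset] by blast+
  moreover have "f ` S \<subseteq> vs2.span (f ` B)"
    using B(3) linear_span_image[OF assms(1), of B] by blast
  ultimately show ?thesis
    using B(1,4) vs2.basis_card_eq_dim[of "f ` B" "f ` S"] by (simp add: card_image image_mono)
qed

section \<open>Complete reducibility\<close>

definition fixed_vectors ::
  "(nat \<Rightarrow> nat) set \<Rightarrow> ('a::field, 'v::ab_group_add) gmod \<Rightarrow> 'v set" where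
  "fixed_vectors G M = {x \<in> mspace M. \<forall>g\<in>G. mact M g x = x}"

text \<open>
  The setting of Maschke's theorem: the characteristic of the field does not divide the order of
  the group. Finite dimension is a spanning condition on \<open>mspace M\<close>, because the ambient type
  is in general infinite-dimensional.
\<close>

locale finite_group_module =
  fixes G :: "(nat \<Rightarrow> nat) set" and M :: "('a::field, 'v::ab_group_add) gmod"
  assumes finite_group: "finite G"
    and id_closed: "id \<in> G"
    and comp_closed: "g \<in> G \<Longrightarrow> h \<in> G \<Longrightarrow> g \<circ> h \<in> G"
    and inv_closed: "g \<in> G \<Longrightarrow> Hilbert_Choice.inv g \<in> G"
    and bij_group: "g \<in> G \<Longrightarrow> bij g"
    and card_nonzero: "of_nat (card G) \<noteq> (0::'a)"
    and gmodule: "gmodule G M"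
    and finitely_spanned: "\<exists>B. finite B \<and> mspace M \<subseteq> module.span (mscale M) B"
begin

sublocale vector_space "mscale M"
  using gmodule by (simp add: gmodule_def)

abbreviation scl (infixr "*\<^sub>M" 75) where "c *\<^sub>M x \<equiv> mscale M c x"

lemma
  shows subspace_M: "subspace (mspace M)"
    and act_closed: "g \<in> G \<Longrightarrow> x \<in> mspace M \<Longrightarrow> mact M g x \<in> mspace M"
    and act_add: "g \<in> G \<Longrightarrow> x \<in> mspace M \<Longrightarrow> y \<in> mspace M
      \<Longrightarrow> mact M g (x + y) = mact M g x + mact M g y"
    and act_scale: "g \<in> G \<Longrightarrow> x \<in> mspace M \<Longrightarrow> mact M g (c *\<^sub>M x) = c *\<^sub>M mact M g x"
    and act_id: "x \<in> mspace M \<Longrightarrow> mact M id x = x"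
    and act_comp: "g \<in> G \<Longrightarrow> h \<in> G \<Longrightarrow> x \<in> mspace M
      \<Longrightarrow> mact M (g \<circ> h) x = mact M g (mact M h x)"
  using gmodule by (auto simp: gmodule_def)

lemma act_zero: "g \<in> G \<Longrightarrow> mact M g 0 = 0"
  using act_scale[of g 0 0] subspace_0[OF subspace_M] by simp

lemma act_sum:
  assumes "g \<in> G" "\<And>i. i \<in> I \<Longrightarrow> f i \<in> mspace M"
  shows "mact M g (\<Sum>i\<in>I. f i) = (\<Sum>i\<in>I. mact M g (f i))"
  using assms(2)
proof (induction I rule: infinite_finite_induct)
  case (insert i I)
  then show ?case
    using act_add[OF assms(1), of "f i" "sum f I"] subspace_sum[OF subspace_M, of I f] by simp
qed (simp_all add: act_zero[OF assms(1)])

lemma act_inv: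
  assumes "g \<in> G" "x \<in> mspace M"
  shows "mact M g (mact M (Hilbert_Choice.inv g) x) = x"
  using act_comp[OF assms(1) inv_closed[OF assms(1)] assms(2)] act_id[OF assms(2)]
    bij_group[OF assms(1)]
  by (simp add: bij_is_surj surj_iff[THEN iffD1])

lemma submodule_iff:
  "submodule G U M \<longleftrightarrow> subspace U \<and> U \<subseteq> mspace M \<and> (\<forall>g\<in>G. \<forall>x\<in>U. mact M g x \<in> U)"
  unfolding submodule_def gmodule_def
  by (auto simp: vector_space_axioms act_add act_scale act_id act_comp subset_eq)

lemma submodule_M: "submodule G (mspace M) M"
  by (simp add: submodule_iff subspace_M act_closed)

lemma irreducible_restrict_iff:
  assumes "W \<subseteq> mspace M"
  shows "irreducible_module G (M\<lparr>mspace := W\<rparr>) \<longleftrightarrow>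
    submodule G W M \<and> W \<noteq> {0} \<and> (\<forall>V. submodule G V M \<longrightarrow> V \<subseteq> W \<longrightarrow> V = {0} \<or> V = W)"
  using assms unfolding irreducible_module_def submodule_def by auto

text \<open>
  Averaging a linear projection \<open>p\<close> onto \<open>V\<close> over the group, that is, taking the mean of
  \<open>g \<circ> p \<circ> g\<^sup>-\<^sup>1\<close>, makes it equivariant. It remains a projection onto \<open>V\<close>, since every
  conjugate maps into \<open>V\<close> and fixes \<open>V\<close> pointwise.
\<close>

lemma maschke_projection:
  assumes "submodule G V M"
  obtains P where "\<forall>x\<in>mspace M. P x \<in> V" "\<forall>v\<in>V. P v = v"
    "\<forall>x\<in>mspace M. \<forall>y\<in>mspace M. P (x + y) = P x + P y"
    "\<forall>c. \<forall>x\<in>mspace M. P (c *\<^sub>M x) = c *\<^sub>M P x"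
    "\<forall>g\<in>G. \<forall>x\<in>mspace M. P (mact M g x) = mact M g (P x)"
proof -
  have V: "subspace V" "V \<subseteq> mspace M" "\<And>g x. g \<in> G \<Longrightarrow> x \<in> V \<Longrightarrow> mact M g x \<in> V"
    using assms by (auto simp: submodule_iff)
  interpret vector_space_pair "mscale M" "mscale M" ..
  have "Vector_Spaces.linear (mscale M) (mscale M) id"
    by unfold_locales auto
  then obtain p where p: "range p \<subseteq> V" "Vector_Spaces.linear (mscale M) (mscale M) p" "\<forall>v\<in>V. p v = v"
    using linear_exists_left_inverse_on[of id V] V(1) by auto
  interpret p: Vector_Spaces.linear "mscale M" "mscale M" p by (rule p(2))
  define T where "T g x = mact M g (p (mact M (Hilbert_Choice.inv g) x))" for g x
  define P where "P x = inverse (of_nat (card G)) *\<^sub>M (\<Sum>g\<in>G. T g x)" for x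
  have pV: "p x \<in> V" and pM: "p x \<in> mspace M" for x
    using p(1) V(2) by auto
  have TV: "T g x \<in> V" if "g \<in> G" for g x
    using that V(3) pV by (simp add: T_def)
  have PV: "P x \<in> V" for x
    unfolding P_def using V(1) TV by (intro subspace_scale subspace_sum) auto
  have Pid: "P v = v" if v: "v \<in> V" for v
  proof -
    have "T g v = v" if g: "g \<in> G" for g
    proof -
      have "p (mact M (Hilbert_Choice.inv g) v) = mact M (Hilbert_Choice.inv g) v"
        using p(3) V(3) v inv_closed[OF g] by blast
      then show ?thesis
        using act_inv[OF g] v V(2) by (auto simp: T_def)
    qed
    then show ?thesis
      using card_nonzero by (simp add: P_def sum_constant_scale)
  qed
  have Padd: "P (x + y) = P x + P y" if "x \<in> mspace M" "y \<in> mspace M" for x y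
    using that
    by (simp add: P_def T_def act_add inv_closed act_closed pM p.add sum.distrib scale_right_distrib)
  have Pscale: "P (c *\<^sub>M x) = c *\<^sub>M P x" if "x \<in> mspace M" for c x
    using that
    by (simp add: P_def T_def act_scale inv_closed act_closed pM p.scale scale_sum_right mult.commute)
  have Pact: "P (mact M h x) = mact M h (P x)" if h: "h \<in> G" and x: "x \<in> mspace M" for h x
  proof -
    \<comment> \<open>Left translation by \<open>h\<close> permutes the summands of the mean.\<close>
    have T: "T (h \<circ> g) (mact M h x) = mact M h (T g x)" if g: "g \<in> G" for g
    proof -
      have "Hilbert_Choice.inv (h \<circ> g) \<circ> h = Hilbert_Choice.inv g"
        using bij_group[OF g] bij_group[OF h]
        by (simp add: o_inv_distrib comp_assoc bij_is_inj)
      then have "mact M (Hilbert_Choice.inv (h \<circ> g)) (mact M h x) = mact M (Hilbert_Choice.inv g) x"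
        using act_comp[OF inv_closed[OF comp_closed[OF h g]] h x] by simp
      then show ?thesis
        using act_comp[OF h g pM] by (simp add: T_def)
    qed
    have inj: "inj_on (\<lambda>g. h \<circ> g) G"
      using bij_is_inj[OF bij_group[OF h]] by (auto simp: inj_on_def inj_def fun_eq_iff)
    moreover have "(\<lambda>g. h \<circ> g) ` G \<subseteq> G"
      using comp_closed h by auto
    ultimately have "(\<lambda>g. h \<circ> g) ` G = G"
      by (intro card_subset_eq finite_group) (auto simp: card_image)
    then have "(\<Sum>g\<in>G. T g (mact M h x)) = (\<Sum>g\<in>G. T (h \<circ> g) (mact M h x))"
      using sum.reindex[OF inj, of "\<lambda>g. T g (mact M h x)"] by simp
    also have "\<dots> = (\<Sum>g\<in>G. mact M h (T g x))"
      using T by simp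
    also have "\<dots> = mact M h (\<Sum>g\<in>G. T g x)"
      using TV V(2) by (subst act_sum[OF h]) auto
    finally have "(\<Sum>g\<in>G. T g (mact M h x)) = mact M h (\<Sum>g\<in>G. T g x)" .
    moreover have "(\<Sum>g\<in>G. T g x) \<in> mspace M"
      using TV V(2) by (intro subspace_sum[OF subspace_M]) auto
    ultimately show ?thesis
      by (simp add: P_def act_scale[OF h])
  qed
  show ?thesis
    using that[of P] PV Pid Padd Pscale Pact by blast
qed

text \<open>
  The complement is the kernel, inside \<open>U\<close>, of an equivariant projection onto \<open>V\<close>.
\<close>

lemma maschke_complement:
  assumes "submodule G V M" "submodule G U M" "V \<subseteq> U"
  obtains K where "submodule G K M" "K \<subseteq> U" "V \<inter> K = {0}"
    "\<forall>x\<in>U. \<exists>v\<in>V. \<exists>k\<in>K. x = v + k"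
proof -
  obtain P where P: "\<forall>x\<in>mspace M. P x \<in> V" "\<forall>v\<in>V. P v = v"
    "\<forall>x\<in>mspace M. \<forall>y\<in>mspace M. P (x + y) = P x + P y"
    "\<forall>c. \<forall>x\<in>mspace M. P (c *\<^sub>M x) = c *\<^sub>M P x"
    "\<forall>g\<in>G. \<forall>x\<in>mspace M. P (mact M g x) = mact M g (P x)"
    by (rule maschke_projection[OF assms(1)])
  have V: "subspace V" "V \<subseteq> mspace M"
    using assms(1) by (auto simp: submodule_iff)
  have U: "subspace U" "U \<subseteq> mspace M" "\<And>g x. g \<in> G \<Longrightarrow> x \<in> U \<Longrightarrow> mact M g x \<in> U"
    using assms(2) by (auto simp: submodule_iff)
  define K where "K = {x \<in> U. P x = 0}"
  have 0: "0 \<in> V" "0 \<in> U" "P 0 = 0"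
    using subspace_0 V U P(2) by auto
  have "subspace K"
    unfolding subspace_def K_def
  proof (intro conjI ballI allI)
    show "0 \<in> {x \<in> U. P x = 0}"
      using 0 by simp
    show "x + y \<in> {x \<in> U. P x = 0}" if "x \<in> {x \<in> U. P x = 0}" "y \<in> {x \<in> U. P x = 0}" for x y
      using that P(3) subspace_add[OF U(1)] U(2) by (auto simp: subset_eq)
    show "c *\<^sub>M x \<in> {x \<in> U. P x = 0}" if "x \<in> {x \<in> U. P x = 0}" for c x
      using that P(4) subspace_scale[OF U(1)] U(2) by auto
  qed
  moreover have "mact M g x \<in> K" if "g \<in> G" "x \<in> K" for g x
    using that P(5) U(2,3) act_zero by (auto simp: K_def)
  ultimately have "submodule G K M"
    using U(2) by (auto simp: submodule_iff K_def)
  moreover have "V \<inter> K = {0}"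
    using 0 P(2) by (auto simp: K_def)
  moreover have "\<forall>x\<in>U. \<exists>v\<in>V. \<exists>k\<in>K. x = v + k"
  proof (intro ballI bexI)
    fix x assume x: "x \<in> U"
    have PV: "P x \<in> V" and PM: "P x \<in> mspace M" and PU: "P x \<in> U"
      using P(1) x U(2) V(2) assms(3) by blast+
    have "x - P x \<in> U"
      using x PU subspace_diff[OF U(1)] by blast
    moreover from this have "P (P x + (x - P x)) = P (P x) + P (x - P x)"
      using P(3) PM U(2) by blast
    ultimately show "x - P x \<in> K"
      using P(2) PV by (simp add: K_def)
    show "P x \<in> V" by (rule PV)
    show "x = P x + (x - P x)" by simp
  qed
  moreover have "K \<subseteq> U"
    by (auto simp: K_def)
  ultimately show ?thesis
    by (intro that)
qed

lemma dim_submodule_less: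
  assumes "submodule G V M" "submodule G U M" "V \<subset> U"
  shows "dim V < dim U"
proof -
  obtain B where "finite B" "mspace M \<subseteq> span B"
    using finitely_spanned by blast
  then show ?thesis
    using assms by (intro dim_strict_mono_subspace[of V U B]) (auto simp: submodule_iff)
qed

text \<open>
  A nonzero submodule of least dimension has no room for a proper nonzero submodule.
\<close>

lemma irreducible_submodule_exists:
  assumes "submodule G U M" "U \<noteq> {0}"
  obtains V where "V \<subseteq> U" "submodule G V M" "irreducible_module G (M\<lparr>mspace := V\<rparr>)"
proof -
  let ?Q = "\<lambda>V. submodule G V M \<and> V \<subseteq> U \<and> V \<noteq> {0}"
  obtain V where V: "?Q V" "\<And>W. ?Q W \<Longrightarrow> dim V \<le> dim W"
    using ex_has_least_nat[of ?Q U dim] assms by blast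
  have "W = {0} \<or> W = V" if "submodule G W M" "W \<subseteq> V" for W
  proof (rule ccontr)
    assume W: "\<not> (W = {0} \<or> W = V)"
    then have "dim W < dim V"
      using that V(1) by (intro dim_submodule_less) auto
    moreover have "dim V \<le> dim W"
      using V W that by auto
    ultimately show False by simp
  qed
  then have "irreducible_module G (M\<lparr>mspace := V\<rparr>)"
    using V(1) by (subst irreducible_restrict_iff) (auto simp: submodule_iff)
  then show ?thesis
    using that V(1) by blast
qed

text \<open>
  Lets an internal direct sum be built one summand at a time: if the members of \<open>D\<close> decompose
  \<open>K\<close> and \<open>U = V \<oplus> K\<close>, then \<open>V\<close> together with the members of \<open>D\<close> decomposes \<open>U\<close>.
\<close>

lemma direct_sum_insert:
  assumes D: "finite D" "V \<notin> D" "bij_betw (\<lambda>w. \<Sum>W\<in>D. w W) (\<Pi>\<^sub>E W\<in>D. W) K"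
    and V: "subspace V" and K: "subspace K" and VK: "V \<inter> K = {0}"
    and U: "subspace U" "V \<subseteq> U" "K \<subseteq> U" "\<And>x. x \<in> U \<Longrightarrow> \<exists>v\<in>V. \<exists>k\<in>K. x = v + k"
  shows "bij_betw (\<lambda>w. \<Sum>W\<in>insert V D. w W) (\<Pi>\<^sub>E W\<in>insert V D. W) U"
  unfolding bij_betw_def
proof (intro conjI equalityI subsetI)
  have sumK: "(\<Sum>W\<in>D. w W) \<in> K" if "w \<in> (\<Pi>\<^sub>E W\<in>insert V D. W)" for w
  proof -
    have "restrict w D \<in> (\<Pi>\<^sub>E W\<in>D. W)"
      using that by auto
    then have "(\<Sum>W\<in>D. restrict w D W) \<in> K"
      using bij_betwE[OF D(3)] by blast
    then show ?thesis by simp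
  qed
  show "inj_on (\<lambda>w. \<Sum>W\<in>insert V D. w W) (\<Pi>\<^sub>E W\<in>insert V D. W)"
  proof (rule inj_onI)
    fix w w' assume w: "w \<in> (\<Pi>\<^sub>E W\<in>insert V D. W)" and w': "w' \<in> (\<Pi>\<^sub>E W\<in>insert V D. W)"
      and "(\<Sum>W\<in>insert V D. w W) = (\<Sum>W\<in>insert V D. w' W)"
    then have eq: "w V + (\<Sum>W\<in>D. w W) = w' V + (\<Sum>W\<in>D. w' W)"
      using D(1,2) by simp
    then have "w V - w' V = (\<Sum>W\<in>D. w' W) - (\<Sum>W\<in>D. w W)"
      by (simp add: algebra_simps)
    moreover have "w V - w' V \<in> V"
      using w w' by (intro subspace_diff[OF V]) auto
    moreover have "(\<Sum>W\<in>D. w' W) - (\<Sum>W\<in>D. w W) \<in> K"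
      using sumK w w' by (intro subspace_diff[OF K])
    ultimately have "w V - w' V \<in> V \<inter> K" by simp
    then have V_eq: "w V = w' V"
      using VK by simp
    have "restrict w D = restrict w' D"
      by (rule inj_onD[OF bij_betw_imp_inj_on[OF D(3)]]) (use V_eq eq w w' in auto)
    then have "w W = w' W" if "W \<in> D" for W
      using that by (metis restrict_apply')
    with V_eq show "w = w'"
      by (intro PiE_ext[OF w w']) auto
  qed
  show "x \<in> U" if x: "x \<in> (\<lambda>w. \<Sum>W\<in>insert V D. w W) ` (\<Pi>\<^sub>E W\<in>insert V D. W)" for x
  proof -
    obtain w where w: "w \<in> (\<Pi>\<^sub>E W\<in>insert V D. W)" "x = w V + (\<Sum>W\<in>D. w W)"
      using x D(1,2) by auto
    then show ?thesis
      using sumK[OF w(1)] U(2,3) by (auto intro!: subspace_add[OF U(1)])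
  qed
  show "x \<in> (\<lambda>w. \<Sum>W\<in>insert V D. w W) ` (\<Pi>\<^sub>E W\<in>insert V D. W)" if x: "x \<in> U" for x
  proof -
    obtain v k where vk: "v \<in> V" "k \<in> K" "x = v + k"
      using U(4)[OF x] by blast
    obtain w where w: "w \<in> (\<Pi>\<^sub>E W\<in>D. W)" "k = (\<Sum>W\<in>D. w W)"
      using vk(2) D(3) by (auto simp: bij_betw_def)
    have "(\<Sum>W\<in>D. (w(V := v)) W) = (\<Sum>W\<in>D. w W)"
      using D(2) by (intro sum.cong) auto
    then have "x = (\<Sum>W\<in>insert V D. (w(V := v)) W)"
      using D(1,2) vk(3) w(2) by simp
    moreover have "w(V := v) \<in> (\<Pi>\<^sub>E W\<in>insert V D. W)"
      using w(1) vk(1) by (intro PiE_fun_upd)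
    ultimately show ?thesis by (rule image_eqI)
  qed
qed

text \<open>
  Split off an irreducible submodule \<open>V\<close> of \<open>U\<close>; a complement \<open>K\<close> of \<open>V\<close> in \<open>U\<close> has smaller
  dimension than \<open>U\<close> and is decomposed by induction.
\<close>

lemma irreducible_decomposition_exists:
  assumes "submodule G U M"
  shows "\<exists>D. irreducible_decomposition G (M\<lparr>mspace := U\<rparr>) D"
  using assms
proof (induction "dim U" arbitrary: U rule: less_induct)
  case less
  show ?case
  proof (cases "U = {0}")
    case True
    then have "irreducible_decomposition G (M\<lparr>mspace := U\<rparr>) {}"
      by (simp add: irreducible_decomposition_def bij_betw_def)
    then show ?thesis by blast
  next
    case False
    then obtain V where V: "V \<subseteq> U" "submodule G V M" "irreducible_module G (M\<lparr>mspace := V\<rparr>)"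
      using irreducible_submodule_exists less.prems by blast
    obtain K where K: "submodule G K M" "K \<subseteq> U" "V \<inter> K = {0}"
      "\<forall>x\<in>U. \<exists>v\<in>V. \<exists>k\<in>K. x = v + k"
      by (rule maschke_complement[OF V(2) less.prems V(1)])
    have "V \<noteq> {0}"
      using V(3) by (simp add: irreducible_module_def)
    then have "V \<noteq> {} \<and> \<not> V \<subseteq> K"
      using K(3) V(2) subspace_0 by (auto simp: submodule_iff)
    \<comment> \<open>This makes \<open>K\<close> strictly smaller than \<open>U\<close>, and keeps \<open>V\<close> out of the decomposition of \<open>K\<close>.\<close>
    then have VK: "\<not> V \<subseteq> K" by blast
    then have "K \<subset> U"
      using V(1) K(2) by blast
    then obtain D where D: "irreducible_decomposition G (M\<lparr>mspace := K\<rparr>) D"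
      using less.hyps[OF dim_submodule_less[OF K(1) less.prems]] K(1) by blast
    have D_K: "W \<subseteq> K" if "W \<in> D" for W
      using D that by (auto simp: irreducible_decomposition_def submodule_def)
    then have "V \<notin> D"
      using VK by blast
    then have "bij_betw (\<lambda>w. \<Sum>W\<in>insert V D. w W) (\<Pi>\<^sub>E W\<in>insert V D. W) U"
      using D V K less.prems
      by (intro direct_sum_insert[of D V K]) (auto simp: irreducible_decomposition_def submodule_iff)
    then have "irreducible_decomposition G (M\<lparr>mspace := U\<rparr>) (insert V D)"
      using D V D_K K(2) by (auto simp: irreducible_decomposition_def submodule_def)
    then show ?thesis by blast
  qed
qed

section \<open>The multiplicity of the trivial module\<close>

lemma decomposition_unique:
  assumes "irreducible_decomposition G M D"
    and "\<And>W. W \<in> D \<Longrightarrow> w W \<in> W" "\<And>W. W \<in> D \<Longrightarrow> w' W \<in> W"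
    and "(\<Sum>W\<in>D. w W) = (\<Sum>W\<in>D. w' W)" "W \<in> D"
  shows "w W = w' W"
proof -
  have inj: "inj_on (\<lambda>w. \<Sum>W\<in>D. w W) (\<Pi>\<^sub>E W\<in>D. W)"
    using assms(1) by (simp add: irreducible_decomposition_def bij_betw_def)
  have "restrict w D = restrict w' D"
    by (rule inj_onD[OF inj]) (use assms(2-4) in auto)
  then show ?thesis
    using assms(5) by (metis restrict_apply')
qed

lemma submodule_fixed_vectors: "submodule G (fixed_vectors G M) M"
  using subspace_M
  by (auto simp: submodule_iff fixed_vectors_def subspace_def act_zero act_add act_scale act_closed)

lemma submodule_Int:
  "submodule G U M \<Longrightarrow> submodule G V M \<Longrightarrow> submodule G (U \<inter> V) M"
  by (auto simp: submodule_iff subspace_inter)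

text \<open>
  The line through a fixed vector is a submodule, so an irreducible module that contains a nonzero
  fixed vector is that line.
\<close>

lemma irreducible_fixed_span:
  assumes "irreducible_module G (M\<lparr>mspace := W\<rparr>)" "W \<subseteq> mspace M"
    and "e \<in> W" "e \<noteq> 0" "e \<in> fixed_vectors G M"
  shows "W = range (\<lambda>c. c *\<^sub>M e)"
proof -
  have W: "subspace W" and irr: "\<And>V. submodule G V M \<Longrightarrow> V \<subseteq> W \<Longrightarrow> V = {0} \<or> V = W"
    using assms(1) irreducible_restrict_iff[OF assms(2)] by (auto simp: submodule_iff)
  have sp: "span {e} = range (\<lambda>c. c *\<^sub>M e)"
    by (simp add: span_singleton)
  have "span {e} \<subseteq> fixed_vectors G M"
    using assms(5) submodule_fixed_vectors by (intro span_minimal) (auto simp: submodule_iff)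
  then have "submodule G (span {e}) M"
    by (fastforce simp: submodule_iff fixed_vectors_def)
  moreover have "span {e} \<subseteq> W"
    using assms(3) W by (intro span_minimal) auto
  moreover have "span {e} \<noteq> {0}"
    using assms(4) span_base[of e "{e}"] by auto
  ultimately show ?thesis
    using irr sp by metis
qed

text \<open>
  A homomorphism to the trivial module cannot distinguish \<open>g.x\<close> from \<open>x\<close>, so if it is injective
  the group fixes every vector. Conversely, an irreducible module of fixed vectors is a line
  \<open>{c e}\<close>, and the coordinate \<open>c e \<mapsto> c\<close> is an isomorphism.
\<close>

lemma irreducible_trivial_iff:
  assumes "irreducible_module G (M\<lparr>mspace := W\<rparr>)" "W \<subseteq> mspace M"
  shows "isomorphic_modules G (M\<lparr>mspace := W\<rparr>) trivial_module \<longleftrightarrow> W \<subseteq> fixed_vectors G M"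
proof
  have W: "subspace W" "\<And>g x. g \<in> G \<Longrightarrow> x \<in> W \<Longrightarrow> mact M g x \<in> W" "W \<noteq> {0}"
    using assms irreducible_restrict_iff[OF assms(2)] by (auto simp: submodule_iff)
  show "W \<subseteq> fixed_vectors G M" if iso: "isomorphic_modules G (M\<lparr>mspace := W\<rparr>) trivial_module"
  proof -
    obtain f where f: "f \<in> GHom G (M\<lparr>mspace := W\<rparr>) trivial_module" "inj_on f W"
      using iso by (auto simp: isomorphic_modules_def bij_betw_def)
    have "f (mact M g x) = f x" if "g \<in> G" "x \<in> W" for g x
      using f(1) that by (simp add: GHom_def trivial_module_def)
    then have "mact M g x = x" if "g \<in> G" "x \<in> W" for g x
      using that W(2) by (intro inj_onD[OF f(2)]) auto
    then show ?thesis
      using assms(2) by (auto simp: fixed_vectors_def)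
  qed
  show "isomorphic_modules G (M\<lparr>mspace := W\<rparr>) trivial_module" if fixed: "W \<subseteq> fixed_vectors G M"
  proof -
    obtain e where e: "e \<in> W" "e \<noteq> 0"
      using W(1,3) subspace_0 by blast
    have We: "W = range (\<lambda>c. c *\<^sub>M e)"
      using irreducible_fixed_span[OF assms e] fixed e(1) by blast
    define f where "f x = (if x \<in> W then THE c. x = c *\<^sub>M e else 0)" for x
    have f: "f (c *\<^sub>M e) = c" for c
      using We e(2) by (auto simp: f_def)
    have "f \<in> GHom G (M\<lparr>mspace := W\<rparr>) trivial_module"
      unfolding GHom_def
    proof (intro CollectI conjI ballI allI impI)
      fix x y c g assume x: "x \<in> mspace (M\<lparr>mspace := W\<rparr>)"
      then obtain a where a: "x = a *\<^sub>M e"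
        using We by auto
      show "f (mscale (M\<lparr>mspace := W\<rparr>) c x) = mscale trivial_module c (f x)"
        by (simp add: a f trivial_module_def)
      show "f x \<in> mspace trivial_module"
        by (simp add: trivial_module_def)
      show "f (x + y) = f x + f y" if y: "y \<in> mspace (M\<lparr>mspace := W\<rparr>)"
      proof -
        obtain b where b: "y = b *\<^sub>M e"
          using We y by auto
        show ?thesis
          using f[of "a + b"] by (simp add: a b f scale_left_distrib)
      qed
      show "f (mact (M\<lparr>mspace := W\<rparr>) g x) = mact trivial_module g (f x)" if "g \<in> G"
        using that x fixed by (auto simp: trivial_module_def fixed_vectors_def)
    qed (simp add: f_def)
    moreover have "bij_betw f W UNIV"
      by (rule bij_betw_byWitness[where f' = "\<lambda>c. c *\<^sub>M e"]) (use We f in auto)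
    ultimately show ?thesis
      by (auto simp: isomorphic_modules_def trivial_module_def)
  qed
qed

text \<open>
  The components of a fixed vector are themselves fixed, because components are unique. An
  irreducible summand either consists of fixed vectors, and is then a trivial line, or has \<open>0\<close> as
  its only fixed vector. So the fixed space is the direct sum of the trivial summands, and one
  nonzero vector from each of them is a basis. In particular the number of trivial summands is the
  same in all decompositions.
\<close>

lemma card_trivial_summands:
  assumes D: "irreducible_decomposition G M D"
  shows "card {W \<in> D. isomorphic_modules G (M\<lparr>mspace := W\<rparr>) trivial_module} =
    dim (fixed_vectors G M)"
proof -
  let ?F = "fixed_vectors G M"
  have fin: "finite D" and irr: "\<And>W. W \<in> D \<Longrightarrow> irreducible_module G (M\<lparr>mspace := W\<rparr>)"
    and sub: "\<And>W. W \<in> D \<Longrightarrow> submodule G W M"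
    and onto: "(\<lambda>w. \<Sum>W\<in>D. w W) ` (\<Pi>\<^sub>E W\<in>D. W) = mspace M"
    using D by (auto simp: irreducible_decomposition_def bij_betw_def)
  have WM: "W \<subseteq> mspace M" and W0: "0 \<in> W" if "W \<in> D" for W
    using sub[OF that] subspace_0 by (auto simp: submodule_iff)
  define T where "T = {W \<in> D. W \<subseteq> ?F}"
  have T: "{W \<in> D. isomorphic_modules G (M\<lparr>mspace := W\<rparr>) trivial_module} = T"
    unfolding T_def using irreducible_trivial_iff irr WM by blast
  have fin_T: "finite T"
    using fin by (simp add: T_def)
  have "\<exists>e. e \<in> W \<and> e \<noteq> 0" if "W \<in> T" for W
    using that irr[of W] W0[of W] by (auto simp: T_def irreducible_module_def)
  then obtain e where e: "\<And>W. W \<in> T \<Longrightarrow> e W \<in> W" "\<And>W. W \<in> T \<Longrightarrow> e W \<noteq> 0"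
    by metis
  have line: "W = range (\<lambda>c. c *\<^sub>M e W)" if "W \<in> T" for W
    using that e[OF that] irr WM by (intro irreducible_fixed_span) (auto simp: T_def)
  have coeff_zero: "c W = 0" if sum0: "(\<Sum>W\<in>T. c W *\<^sub>M e W) = 0" and W: "W \<in> T" for c W
  proof -
    \<comment> \<open>Extended by zero, the relation compares two families of components of the vector \<open>0\<close>.\<close>
    let ?w = "\<lambda>W. if W \<in> T then c W *\<^sub>M e W else 0"
    have "(\<Sum>W\<in>D. ?w W) = (\<Sum>W\<in>T. c W *\<^sub>M e W)"
      using fin by (simp add: sum.If_cases T_def Int_def)
    then have "(\<Sum>W\<in>D. ?w W) = (\<Sum>W\<in>D. 0)"
      using sum0 by simp
    moreover have "?w W \<in> W" if "W \<in> D" for W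
      using that e(1) W0 sub subspace_scale by (auto simp: submodule_iff)
    ultimately have "?w W = 0"
      using W W0 by (intro decomposition_unique[OF D, of ?w "\<lambda>_. 0"]) (auto simp: T_def)
    then show ?thesis
      using W e(2) by simp
  qed
  have inj: "inj_on e T"
  proof (rule inj_onI, rule ccontr)
    fix V W assume VW: "V \<in> T" "W \<in> T" "e V = e W" "V \<noteq> W"
    then show False
      using line[OF VW(1)] line[OF VW(2)] by simp
  qed
  have "independent (e ` T)"
  proof (rule independent_if_scalars_zero)
    fix c x assume "(\<Sum>x\<in>e ` T. c x *\<^sub>M x) = 0" "x \<in> e ` T"
    then show "c x = 0"
      using coeff_zero[of "\<lambda>W. c (e W)"] by (auto simp: sum.reindex[OF inj])
  qed (use fin_T in simp)
  moreover have "e ` T \<subseteq> ?F"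
    using e(1) by (auto simp: T_def)
  moreover have "?F \<subseteq> span (e ` T)"
  proof
    fix x assume x: "x \<in> ?F"
    then have "x \<in> mspace M"
      by (simp add: fixed_vectors_def)
    then obtain w where w: "w \<in> (\<Pi>\<^sub>E W\<in>D. W)" "x = (\<Sum>W\<in>D. w W)"
      using onto by blast
    have wW: "w W \<in> W" "w W \<in> mspace M" if "W \<in> D" for W
      using w(1) WM that by auto
    have "w W \<in> ?F" if W: "W \<in> D" for W
    proof -
      have "mact M g (w W) = w W" if g: "g \<in> G" for g
      proof (rule decomposition_unique[OF D _ _ _ W, of "\<lambda>W. mact M g (w W)" w])
        show "(\<Sum>W\<in>D. mact M g (w W)) = (\<Sum>W\<in>D. w W)"
          using act_sum[OF g, of D w] x g wW(2) w(2) by (simp add: fixed_vectors_def)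
      qed (use wW g sub in \<open>auto simp: submodule_iff\<close>)
      then show ?thesis
        using wW(2)[OF W] by (simp add: fixed_vectors_def)
    qed
    moreover have "W \<inter> ?F = {0}" if "W \<in> D" "W \<notin> T" for W
    proof -
      have "W \<inter> ?F = {0} \<or> W \<inter> ?F = W"
        using irr[OF that(1)] irreducible_restrict_iff[OF WM[OF that(1)]]
          submodule_Int[OF sub[OF that(1)] submodule_fixed_vectors] by blast
      then show ?thesis
        using that by (auto simp: T_def)
    qed
    ultimately have zero: "w W = 0" if "W \<in> D" "W \<notin> T" for W
      using that wW(1) by blast
    have "w W \<in> span (e ` T)" if W: "W \<in> D" for W
    proof (cases "W \<in> T")
      case True
      then obtain c where "w W = c *\<^sub>M e W"
        using line[OF True] wW(1)[OF W] by auto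
      then show ?thesis
        using True by (simp add: span_scale span_base)
    next
      case False
      then show ?thesis
        using zero W by (simp add: span_zero)
    qed
    then show "x \<in> span (e ` T)"
      unfolding w(2) by (rule span_sum)
  qed
  ultimately have "card (e ` T) = dim ?F"
    by (intro basis_card_eq_dim)
  then show ?thesis
    using T card_image[OF inj] by simp
qed

lemma multiplicity_trivial:
  "multiplicity_of G trivial_module M = dim (fixed_vectors G M)"
  unfolding multiplicity_of_def
proof (rule the_equality)
  obtain D where "irreducible_decomposition G (M\<lparr>mspace := mspace M\<rparr>) D"
    using irreducible_decomposition_exists[OF submodule_M] by blast
  then have D: "irreducible_decomposition G M D"
    by simp
  show "\<exists>D. irreducible_decomposition G M D \<and> dim (fixed_vectors G M) =
      card {W \<in> D. isomorphic_modules G (M\<lparr>mspace := W\<rparr>) trivial_module}"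
    using D card_trivial_summands[OF D] by (intro exI[of _ D]) simp
qed (auto simp: card_trivial_summands)

end

text \<open>
  A homomorphism from the trivial module is determined by the image of \<open>1\<close>, which may be any fixed
  vector.
\<close>

lemma dim_hom_trivial:
  fixes k n :: nat
  defines "M \<equiv> (tensor_power k n :: ('a::field, nat list \<Rightarrow> 'a) gmod)"
  shows "Z_dim k n (GHom G (trivial_module :: ('a, 'a) gmod) M) =
    vector_space.dim fun_scale (fixed_vectors G M)"
proof -
  let ?s = "fun_scale :: 'a \<Rightarrow> (nat list \<Rightarrow> 'a) \<Rightarrow> nat list \<Rightarrow> 'a"
  let ?t = "hom_scale M :: 'a \<Rightarrow> ('a \<Rightarrow> nat list \<Rightarrow> 'a) \<Rightarrow> 'a \<Rightarrow> nat list \<Rightarrow> 'a"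
  interpret vs1: vector_space ?s
    by (rule vector_space_fun_scale)
  interpret vs2: vector_space ?t
    unfolding M_def by (rule vector_space_hom_scale)
  interpret vector_space_pair ?s ?t ..
  have scale: "mscale M = fun_scale"
    by (simp add: M_def tensor_power_def)
  define \<phi> where "\<phi> x = (\<lambda>c. fun_scale c x)" for x :: "nat list \<Rightarrow> 'a"
  have linear: "Vector_Spaces.linear ?s ?t \<phi>"
    by unfold_locales
      (auto simp: \<phi>_def hom_scale_def scale vs1.scale_right_distrib mult.commute fun_eq_iff)
  have inj: "inj \<phi>"
  proof (rule injI)
    fix x y assume "\<phi> x = \<phi> y"
    then have "\<phi> x 1 = \<phi> y 1" by simp
    then show "x = y" by (simp add: \<phi>_def)
  qed
  have "\<phi> ` fixed_vectors G M = GHom G (trivial_module :: ('a, 'a) gmod) M"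
  proof (intro equalityI subsetI)
    fix f assume "f \<in> \<phi> ` fixed_vectors G M"
    then obtain x where x: "f = \<phi> x" "x \<in> fixed_vectors G M" by blast
    have "mact M g (fun_scale c x) = fun_scale c (mact M g x)" for g c
      by (simp add: M_def tensor_power_def fun_scale_def)
    moreover have "fun_scale c x \<in> mspace M" for c
      using x(2) by (simp add: fixed_vectors_def M_def tensor_power_def fun_scale_def)
    ultimately show "f \<in> GHom G (trivial_module :: ('a, 'a) gmod) M"
      using x by (auto simp: GHom_def trivial_module_def \<phi>_def scale fixed_vectors_def
          vs1.scale_left_distrib)
  next
    fix f assume f: "f \<in> GHom G (trivial_module :: ('a, 'a) gmod) M"
    have line: "f c = fun_scale c (f 1)" for c
    proof -
      have "\<forall>c x. f (c * x) = fun_scale c (f x)"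
        using f by (simp add: GHom_def trivial_module_def scale)
      then have "f (c * 1) = fun_scale c (f 1)" by blast
      then show ?thesis by simp
    qed
    have "f = \<phi> (f 1)"
      unfolding \<phi>_def by (rule ext) (rule line)
    moreover have "f 1 \<in> fixed_vectors G M"
      using f by (auto simp: GHom_def trivial_module_def fixed_vectors_def)
    ultimately show "f \<in> \<phi> ` fixed_vectors G M" by blast
  qed
  then have "vs2.dim (GHom G (trivial_module :: ('a, 'a) gmod) M) = vs1.dim (fixed_vectors G M)"
    using dim_injective_image[OF linear, of "fixed_vectors G M"] inj inj_on_subset by fastforce
  then show ?thesis
    by (simp add: Z_dim_def M_def)
qed

section \<open>Fixed tensors and orbits of tuples\<close>

lemma finite_tuples: "finite (tuples k n)"
  unfolding tuples_def using finite_lists_length_eq[of "{1..n}" k] by (simp add: conj_commute)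

lemma finite_Sym: "finite (Sym n)"
  by (simp add: Sym_def finite_permutations)

lemma card_Sym: "card (Sym n) = fact n"
  unfolding Sym_def by (rule card_permutations) auto

lemma Sym_mono: "m \<le> n \<Longrightarrow> Sym m \<subseteq> Sym n"
  unfolding Sym_def by (auto elim!: permutes_subset)

lemma map_Sym_tuples:
  assumes "\<sigma> \<in> Sym n" "xs \<in> tuples k n"
  shows "map \<sigma> xs \<in> tuples k n"
  using assms permutes_in_image[of \<sigma> "{1..n}"] by (auto simp: Sym_def tuples_def)

lemma finite_group_module_tensor_power:
  assumes "m \<le> n"
  shows "finite_group_module (Sym m) (tensor_power k n :: ('a::field_char_0, nat list \<Rightarrow> 'a) gmod)"
proof
  let ?M = "tensor_power k n :: ('a, nat list \<Rightarrow> 'a) gmod"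
  interpret vector_space "fun_scale :: 'a \<Rightarrow> (nat list \<Rightarrow> 'a) \<Rightarrow> _"
    by (rule vector_space_fun_scale)
  show "gmodule (Sym m) ?M"
    using gmodule_tensor_power Sym_mono[OF assms] by (rule gmodule_mono)
  have "f \<in> span (basis_vec ` tuples k n)" if f: "f \<in> mspace ?M" for f
  proof -
    have "(\<Sum>r\<in>A. fun_scale (f r) (basis_vec r)) xs = (if xs \<in> A then f xs else 0)"
      if "finite A" for A xs
      using that by induction (auto simp: fun_scale_def basis_vec_def)
    then have "(\<Sum>r\<in>tuples k n. fun_scale (f r) (basis_vec r)) = f"
      using f finite_tuples by (auto simp: fun_eq_iff tensor_power_def)
    moreover have "(\<Sum>r\<in>tuples k n. fun_scale (f r) (basis_vec r)) \<in> span (basis_vec ` tuples k n)"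
      by (intro span_sum span_scale span_base) auto
    ultimately show ?thesis by simp
  qed
  moreover have "mscale ?M = fun_scale"
    by (simp add: tensor_power_def)
  ultimately show "\<exists>B. finite B \<and> mspace ?M \<subseteq> module.span (mscale ?M) B"
    using finite_tuples by (intro exI[of _ "basis_vec ` tuples k n"]) auto
qed (simp_all add: finite_Sym card_Sym,
    auto simp: Sym_def permutes_id permutes_compose permutes_inv intro: permutes_bij)

text \<open>
  The restriction makes every \<open>tuple_action k n \<sigma>\<close> an extensional function, as the elements of
  \<^const>\<open>BijGroup\<close> are.
\<close>

definition tuple_action :: "nat \<Rightarrow> nat \<Rightarrow> (nat \<Rightarrow> nat) \<Rightarrow> nat list \<Rightarrow> nat list" where
  "tuple_action k n \<sigma> = restrict (map \<sigma>) (tuples k n)"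

lemma group_action_tuples:
  assumes "m \<le> n"
  shows "group_action (sym_group m) (tuples k n) (tuple_action k n)"
proof -
  have Sym: "\<sigma> \<in> Sym n \<and> Hilbert_Choice.inv \<sigma> \<in> Sym n" if "\<sigma> \<in> carrier (sym_group m)" for \<sigma>
    using that Sym_mono[OF assms] permutes_inv by (auto simp: Sym_def sym_group_carrier)
  have Bij: "tuple_action k n \<sigma> \<in> Bij (tuples k n)" if \<sigma>: "\<sigma> \<in> carrier (sym_group m)" for \<sigma>
  proof -
    have "bij \<sigma>"
      using \<sigma> permutes_bij by (auto simp: sym_group_carrier)
    then have "bij_betw (map \<sigma>) (tuples k n) (tuples k n)"
      using Sym[OF \<sigma>] map_Sym_tuples[of _ n _ k]
      by (intro bij_betw_byWitness[where f' = "map (Hilbert_Choice.inv \<sigma>)"])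
        (auto simp: bij_is_inj bij_is_surj surj_iff[THEN iffD1])
    then show ?thesis
      by (simp add: Bij_def tuple_action_def bij_betw_restrict_eq)
  qed
  have "tuple_action k n (\<sigma> \<circ> \<tau>) = compose (tuples k n) (tuple_action k n \<sigma>) (tuple_action k n \<tau>)"
    if "\<tau> \<in> carrier (sym_group m)" for \<sigma> \<tau>
    using map_Sym_tuples Sym[OF that]
    by (auto simp: tuple_action_def compose_def fun_eq_iff)
  then have "tuple_action k n \<in> hom (sym_group m) (BijGroup (tuples k n))"
    using Bij by (auto simp: hom_def BijGroup_def sym_group_mult)
  then show ?thesis
    by (simp add: group_action_def group_hom_def group_hom_axioms_def sym_group_is_group
        group_BijGroup)
qed

lemma fixed_vectors_tensor_power_iff:
  fixes f :: "nat list \<Rightarrow> 'a::field"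
  assumes "m \<le> n"
  shows "f \<in> fixed_vectors (Sym m) (tensor_power k n) \<longleftrightarrow>
    (\<forall>xs. xs \<notin> tuples k n \<longrightarrow> f xs = 0) \<and>
    (\<forall>\<sigma>\<in>Sym m. \<forall>xs\<in>tuples k n. f (map \<sigma> xs) = f xs)"
proof -
  have inv: "Hilbert_Choice.inv \<sigma> \<in> Sym m" "Hilbert_Choice.inv (Hilbert_Choice.inv \<sigma>) = \<sigma>"
    if "\<sigma> \<in> Sym m" for \<sigma>
    using that by (auto simp: Sym_def permutes_inv permutes_inv_inv)
  have out: "map \<sigma> xs \<notin> tuples k n" if "\<sigma> \<in> Sym m" "xs \<notin> tuples k n" for \<sigma> xs
    using map_inv_tuples[of "Hilbert_Choice.inv \<sigma>" n xs k] inv[OF that(1)] that(2) Sym_mono[OF assms]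
    by auto
  have "f \<in> fixed_vectors (Sym m) (tensor_power k n) \<longleftrightarrow>
      (\<forall>xs. xs \<notin> tuples k n \<longrightarrow> f xs = 0) \<and> (\<forall>\<sigma>\<in>Sym m. \<forall>xs. f (map (Hilbert_Choice.inv \<sigma>) xs) = f xs)"
    by (auto simp: fixed_vectors_def tensor_power_def fun_eq_iff)
  also have "\<dots> \<longleftrightarrow> (\<forall>xs. xs \<notin> tuples k n \<longrightarrow> f xs = 0) \<and> (\<forall>\<sigma>\<in>Sym m. \<forall>xs. f (map \<sigma> xs) = f xs)"
    using inv by metis
  also have "\<dots> \<longleftrightarrow> (\<forall>xs. xs \<notin> tuples k n \<longrightarrow> f xs = 0) \<and>
      (\<forall>\<sigma>\<in>Sym m. \<forall>xs\<in>tuples k n. f (map \<sigma> xs) = f xs)"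
    using out by metis
  finally show ?thesis .
qed

text \<open>
  A function on tuples is fixed iff it is constant on the orbits, so the indicator functions of the
  orbits form a basis of the fixed space.
\<close>

lemma dim_fixed_vectors:
  assumes "m \<le> n"
  shows "vector_space.dim fun_scale
      (fixed_vectors (Sym m) (tensor_power k n :: ('a::field, nat list \<Rightarrow> 'a) gmod)) =
    card (orbits (sym_group m) (tuples k n) (tuple_action k n))"
proof -
  interpret vector_space "fun_scale :: 'a \<Rightarrow> (nat list \<Rightarrow> 'a) \<Rightarrow> _"
    by (rule vector_space_fun_scale)
  interpret action: group_action "sym_group m" "tuples k n" "tuple_action k n"
    by (rule group_action_tuples[OF assms])
  let ?F = "fixed_vectors (Sym m) (tensor_power k n :: ('a, nat list \<Rightarrow> 'a) gmod)"
  let ?O = "orbits (sym_group m) (tuples k n) (tuple_action k n)"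
  let ?ind = "\<lambda>X xs. if xs \<in> X then 1 else (0::'a)"
  have carrier: "carrier (sym_group m) = Sym m"
    by (simp add: sym_group_def Sym_def)
  have orbit: "orbit (sym_group m) (tuple_action k n) xs = {map \<sigma> xs |\<sigma>. \<sigma> \<in> Sym m}"
    if "xs \<in> tuples k n" for xs
    using that by (auto simp: orbit_def carrier tuple_action_def)
  have cover: "\<Union>?O = tuples k n"
    by (rule action.orbits_coverture)
  have fin: "finite ?O"
    using cover finite_tuples by (metis finite_UnionD)
  have disj: "X = Y" if "X \<in> ?O" "Y \<in> ?O" "xs \<in> X" "xs \<in> Y" for X Y xs
    using action.disjoint_union[of X Y] that by blast
  have nonempty: "X \<noteq> {}" if "X \<in> ?O" for X
    using that action.orbit_refl by (auto simp: orbits_def)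
  have same_orbit: "\<exists>X\<in>?O. xs \<in> X \<and> map \<sigma> xs \<in> X" if "\<sigma> \<in> Sym m" "xs \<in> tuples k n" for \<sigma> xs
  proof (intro bexI conjI)
    show "orbit (sym_group m) (tuple_action k n) xs \<in> ?O"
      using that by (auto simp: orbits_def)
  qed (use that action.orbit_refl orbit in auto)
  have eval: "(\<Sum>X\<in>?O. fun_scale (c X) (?ind X)) xs = c X" if "X \<in> ?O" "xs \<in> X" for c X xs
  proof -
    have "(\<Sum>X\<in>A. fun_scale (c X) (?ind X)) xs = (\<Sum>X\<in>A. c X * ?ind X xs)" if "finite A" for A
      using that by induction (auto simp: fun_scale_def)
    then have "(\<Sum>X\<in>?O. fun_scale (c X) (?ind X)) xs = (\<Sum>Y\<in>?O. c Y * ?ind Y xs)"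
      using fin by simp
    also have "\<dots> = (\<Sum>Y\<in>?O. if Y = X then c X else 0)"
      using disj that by (intro sum.cong) auto
    finally show ?thesis
      using that(1) fin by simp
  qed
  have inj: "inj_on ?ind ?O"
  proof (rule inj_onI)
    fix X Y assume "X \<in> ?O" "Y \<in> ?O" and eq: "?ind X = ?ind Y"
    have "xs \<in> X \<longleftrightarrow> xs \<in> Y" for xs
      using fun_cong[OF eq, of xs] by (auto split: if_splits)
    then show "X = Y" by blast
  qed
  have "independent (?ind ` ?O)"
  proof (rule independent_if_scalars_zero)
    fix c x assume sum: "(\<Sum>x\<in>?ind ` ?O. fun_scale (c x) x) = 0" and "x \<in> ?ind ` ?O"
    then obtain X where X: "X \<in> ?O" "x = ?ind X" by blast
    obtain xs where xs: "xs \<in> X"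
      using nonempty[OF X(1)] by blast
    have "(\<Sum>X\<in>?O. fun_scale (c (?ind X)) (?ind X)) = 0"
      using sum by (simp add: sum.reindex[OF inj])
    then show "c x = 0"
      using eval[OF X(1) xs, of "\<lambda>X. c (?ind X)"] X(2) by simp
  qed (use fin in simp)
  moreover have "?ind ` ?O \<subseteq> ?F"
  proof clarify
    fix X assume X: "X \<in> ?O"
    have "map \<sigma> xs \<in> X \<longleftrightarrow> xs \<in> X" if "\<sigma> \<in> Sym m" "xs \<in> tuples k n" for \<sigma> xs
      using same_orbit[OF that] disj X by blast
    moreover have "X \<subseteq> tuples k n"
      using X cover by blast
    ultimately show "?ind X \<in> ?F"
      by (auto simp: fixed_vectors_tensor_power_iff[OF assms])
  qed
  moreover have "?F \<subseteq> span (?ind ` ?O)"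
  proof
    fix f assume f: "f \<in> ?F"
    define c where "c X = f (SOME xs. xs \<in> X)" for X
    have const: "f xs = c X" if X: "X \<in> ?O" and xs: "xs \<in> X" for X xs
    proof -
      obtain ys where ys: "ys \<in> tuples k n" "X = {map \<sigma> ys |\<sigma>. \<sigma> \<in> Sym m}"
        using X orbit by (auto simp: orbits_def)
      have "f zs = f ys" if "zs \<in> X" for zs
        using that ys f by (auto simp: fixed_vectors_tensor_power_iff[OF assms])
      then show ?thesis
        using xs by (metis c_def someI)
    qed
    have "f = (\<Sum>X\<in>?O. fun_scale (c X) (?ind X))"
    proof
      fix xs
      show "f xs = (\<Sum>X\<in>?O. fun_scale (c X) (?ind X)) xs"
      proof (cases "xs \<in> tuples k n")
        case True
        then obtain X where X: "X \<in> ?O" "xs \<in> X"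
          using cover by blast
        show ?thesis
          using eval[OF X, of c] const[OF X] by simp
      next
        case False
        have "(\<Sum>X\<in>A. fun_scale (c X) (?ind X)) xs = 0" if "finite A" "A \<subseteq> ?O" for A
          using that cover False by induction (auto simp: fun_scale_def)
        then show ?thesis
          using f False fin by (simp add: fixed_vectors_tensor_power_iff[OF assms])
      qed
    qed
    moreover have "(\<Sum>X\<in>?O. fun_scale (c X) (?ind X)) \<in> span (?ind ` ?O)"
      by (intro span_sum span_scale span_base) auto
    ultimately show "f \<in> span (?ind ` ?O)" by simp
  qed
  ultimately have "card (?ind ` ?O) = dim ?F"
    by (intro basis_card_eq_dim)
  then show ?thesis
    by (simp add: card_image[OF inj])
qed

section \<open>Counting fixed points\<close>

lemma card_fixed_tuples:
  "card {xs \<in> tuples k n. map \<sigma> xs = xs} = fixed_points n \<sigma> ^ k"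
proof -
  have "map \<sigma> xs = xs \<longleftrightarrow> (\<forall>x\<in>set xs. \<sigma> x = x)" for xs
    by (induction xs) auto
  then have "{xs \<in> tuples k n. map \<sigma> xs = xs} = {xs. set xs \<subseteq> {i \<in> {1..n}. \<sigma> i = i} \<and> length xs = k}"
    by (auto simp: tuples_def)
  then show ?thesis
    by (simp add: card_lists_length_eq fixed_points_def)
qed

text \<open>
  The group is \<open>S\<^sub>m\<close>, while fixed points are counted in the larger set \<open>{1..n}\<close> whose elements
  are the entries of the tuples. The case \<open>m = n - 1\<close> is the restriction of the \<open>S\<^sub>n\<close>-module
  to \<open>S\<^sub>n\<^sub>-\<^sub>1\<close>.
\<close>

lemma burnside_fixed_vectors:
  assumes "m \<le> n"
  shows "fact m * vector_space.dim fun_scale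
      (fixed_vectors (Sym m) (tensor_power k n :: ('a::field, nat list \<Rightarrow> 'a) gmod)) =
    (\<Sum>\<sigma>\<in>Sym m. fixed_points n \<sigma> ^ k)"
proof -
  interpret action: group_action "sym_group m" "tuples k n" "tuple_action k n"
    by (rule group_action_tuples[OF assms])
  have carrier: "carrier (sym_group m) = Sym m"
    by (simp add: sym_group_def Sym_def)
  have "invariants (tuples k n) (tuple_action k n) \<sigma> = {xs \<in> tuples k n. map \<sigma> xs = xs}" for \<sigma>
    by (auto simp: invariants_def tuple_action_def)
  then show ?thesis
    using action.burnside finite_tuples
    by (simp add: carrier finite_Sym order_def card_Sym card_fixed_tuples dim_fixed_vectors[OF assms]
        mult.commute)
qed

lemma fixed_points_pred:
  assumes "n \<ge> 1" "\<tau> \<in> Sym (n - 1)"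
  shows "fixed_points n \<tau> = fixed_points (n - 1) \<tau> + 1"
proof -
  have "\<tau> n = n"
    using assms Sym_pred by blast
  moreover have "{1..n} = insert n {1..n - 1}"
    using assms(1) by auto
  ultimately have "{i \<in> {1..n}. \<tau> i = i} = insert n {i \<in> {1..n - 1}. \<tau> i = i}"
    by auto
  moreover have "n \<notin> {i \<in> {1..n - 1}. \<tau> i = i}"
    using assms(1) by auto
  ultimately show ?thesis
    by (simp add: fixed_points_def)
qed

text \<open>
  Conjugation by the transposition of \<open>i\<close> and \<open>n\<close> carries the stabilizer of \<open>i\<close> to the
  stabilizer of \<open>n\<close>, which is \<open>S\<^sub>n\<^sub>-\<^sub>1\<close>, and preserves the number of fixed points.
\<close>

lemma sum_fixed_points_at:
  assumes "i \<in> {1..n}"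
  shows "(\<Sum>\<sigma> | \<sigma> \<in> Sym n \<and> \<sigma> i = i. fixed_points n \<sigma> ^ k) =
    (\<Sum>\<sigma>\<in>Sym (n - 1). fixed_points n \<sigma> ^ k)"
proof -
  have n: "n \<ge> 1" using assms by auto
  let ?t = "transpose i n"
  let ?c = "\<lambda>\<sigma>. ?t \<circ> \<sigma> \<circ> ?t"
  have t: "?t permutes {1..n}"
    using assms n by (intro permutes_swap_id) auto
  have cc: "?c (?c \<sigma>) = \<sigma>" for \<sigma>
    by (simp add: fun_eq_iff)
  have c: "?c \<sigma> \<in> Sym n" if "\<sigma> \<in> Sym n" for \<sigma>
    using that t by (simp add: Sym_def permutes_compose)
  have "fixed_points n (?c \<sigma>) = fixed_points n \<sigma>" for \<sigma>
    unfolding fixed_points_def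
  proof (rule bij_betw_same_card)
    have in_n: "?t x \<in> {1..n} \<longleftrightarrow> x \<in> {1..n}" for x
      by (rule permutes_in_image[OF t])
    show "bij_betw ?t {j \<in> {1..n}. ?c \<sigma> j = j} {j \<in> {1..n}. \<sigma> j = j}"
      by (rule bij_betw_byWitness[where f' = ?t])
        (use in_n in \<open>auto simp del: atLeastAtMost_iff simp: transpose_eq_iff\<close>)
  qed
  then show ?thesis
    unfolding Sym_pred[OF n]
    by (intro sum.reindex_bij_witness[of _ ?c ?c]) (use cc c in auto)
qed

text \<open>
  One of the \<open>k + 1\<close> factors is written as the sum of \<open>1\<close> over the fixed points \<open>i\<close> of \<open>\<sigma>\<close>;
  exchanging the sums leaves, for each \<open>i\<close>, a sum over the stabilizer of \<open>i\<close>.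
\<close>

lemma sum_fixed_points_Suc:
  assumes "n \<ge> 1"
  shows "(\<Sum>\<sigma>\<in>Sym n. fixed_points n \<sigma> ^ (k + 1)) =
    n * (\<Sum>\<sigma>\<in>Sym (n - 1). fixed_points n \<sigma> ^ k)"
proof -
  have "(\<Sum>\<sigma>\<in>Sym n. fixed_points n \<sigma> ^ (k + 1)) =
      (\<Sum>\<sigma>\<in>Sym n. \<Sum>i\<in>{i \<in> {1..n}. \<sigma> i = i}. fixed_points n \<sigma> ^ k)"
    by (simp add: fixed_points_def)
  also have "\<dots> = (\<Sum>i\<in>{1..n}. \<Sum>\<sigma> | \<sigma> \<in> Sym n \<and> \<sigma> i = i. fixed_points n \<sigma> ^ k)"
    by (rule sum.swap_restrict) (simp_all add: finite_Sym)
  also have "\<dots> = (\<Sum>i\<in>{1..n}. \<Sum>\<sigma>\<in>Sym (n - 1). fixed_points n \<sigma> ^ k)"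
    by (rule sum.cong[OF refl sum_fixed_points_at])
  finally show ?thesis by simp
qed

text \<open>
  The numerical form of Frobenius reciprocity for \<open>N \<otimes> M\<^sub>n\<close> with \<open>N\<close> the \<open>k\<close>-th tensor
  power of \<open>M\<^sub>n\<close>, where \<open>M\<^sub>n\<close> is induced from the trivial module of \<open>S\<^sub>n\<^sub>-\<^sub>1\<close>.
\<close>

lemma dim_fixed_vectors_Suc:
  assumes "n \<ge> 1"
  shows "vector_space.dim fun_scale
      (fixed_vectors (Sym n) (tensor_power (k + 1) n :: ('a::field, nat list \<Rightarrow> 'a) gmod)) =
    vector_space.dim fun_scale
      (fixed_vectors (Sym (n - 1)) (tensor_power k n :: ('a, nat list \<Rightarrow> 'a) gmod))"
    (is "?d = ?d'")
proof -
  have "fact n * ?d = n * (fact (n - 1) * ?d')"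
    unfolding burnside_fixed_vectors[OF le_refl] burnside_fixed_vectors[OF diff_le_self]
    by (rule sum_fixed_points_Suc[OF assms])
  also have "\<dots> = fact n * ?d'"
    using assms by (simp add: fact_reduce[of n])
  finally show ?thesis by simp
qed

theorem proposition3p8:
  fixes k n :: nat
  assumes "n \<ge> 1"
  shows
    "1 / fact n * (\<Sum>\<sigma>\<in>Sym n. of_nat (fixed_points n \<sigma>) ^ (k + 1))
       = (of_nat (multiplicity_of (Sym n) (trivial_module :: ('a::field_char_0, 'a) gmod)
            (tensor_power (k + 1) n)) :: rat) \<and>
     multiplicity_of (Sym n) (trivial_module :: ('a, 'a) gmod) (tensor_power (k + 1) n)
       = Z_dim (k + 1) n (Z_module (k + 1) n (trivial_module :: ('a, 'a) gmod)) \<and>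
     Z_dim (k + 1) n (Z_module (k + 1) n (trivial_module :: ('a, 'a) gmod))
       = Z_dim k n (Z_half_module k n (trivial_module :: ('a, 'a) gmod)) \<and>
     Z_dim k n (Z_half_module k n (trivial_module :: ('a, 'a) gmod))
       = multiplicity_of (Sym (n - 1)) (trivial_module :: ('a, 'a) gmod) (tensor_power k n) \<and>
     (of_nat (multiplicity_of (Sym (n - 1)) (trivial_module :: ('a, 'a) gmod)
            (tensor_power k n)) :: rat)
       = 1 / fact (n - 1) * (\<Sum>\<tau>\<in>Sym (n - 1). (of_nat (fixed_points (n - 1) \<tau>) + 1) ^ k)"
proof -
  let ?d = "\<lambda>m j. vector_space.dim fun_scale
    (fixed_vectors (Sym m) (tensor_power j n :: ('a, nat list \<Rightarrow> 'a) gmod))"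
  have mult: "multiplicity_of (Sym m) (trivial_module :: ('a, 'a) gmod) (tensor_power j n) = ?d m j"
    if "m \<le> n" for m j
    using finite_group_module.multiplicity_trivial[OF finite_group_module_tensor_power[OF that, of j]]
    by (simp add: tensor_power_def)
  have Z: "Z_dim j n (Z_module j n (trivial_module :: ('a, 'a) gmod)) = ?d n j"
    and Z_half: "Z_dim j n (Z_half_module j n (trivial_module :: ('a, 'a) gmod)) = ?d (n - 1) j" for j
    by (simp_all add: Z_module_def Z_half_module_def dim_hom_trivial)
  have average: "(of_nat (?d m j) :: rat) = 1 / fact m * (\<Sum>\<sigma>\<in>Sym m. of_nat (fixed_points n \<sigma>) ^ j)"
    if "m \<le> n" for m j
    using arg_cong[OF burnside_fixed_vectors[OF that, of j, where 'a = 'a], of "of_nat :: nat \<Rightarrow> rat"]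
    by (simp add: field_simps)
  have "(\<Sum>\<tau>\<in>Sym (n - 1). (of_nat (fixed_points n \<tau>) :: rat) ^ k) =
      (\<Sum>\<tau>\<in>Sym (n - 1). (of_nat (fixed_points (n - 1) \<tau>) + 1) ^ k)"
    by (intro sum.cong refl) (simp add: fixed_points_pred[OF assms] add.commute)
  then show ?thesis
    using mult[of n] mult[of "n - 1"] Z Z_half average[of n "k + 1"] average[of "n - 1" k]
      dim_fixed_vectors_Suc[OF assms, of k, where 'a = 'a]
    by simp
qed

end
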